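(* Let $(K,P)$ be a random element of $H\times L$ that is space-homogeneous stationary, i.e. $\theta_s(K,P)\overset{d}{=}(K,P)$ for all $s\in\mathbb{R}$, and let $l_n=P_n-P_{n-1}$, $n\in\mathbb{Z}$. Suppose that the sequence $\big((K_{t+P_{n-1}}-K_{P_{n-1}},\,0\le t<l_n),\,l_n\big)_{n\in\mathbb{Z}}$ is independent. (i) For every nonnegative measurable function $f$, $$\mathbb{E}\big[f((K_{t+P_0}-K_{P_0},\,0\le t<l_1),\,l_1)\big]=\mathbb{E}\Big[\frac1{l_0}\Big]^{-1}\mathbb{E}\Big[f((K_{t+P_{-1}}-K_{P_{-1}},\,0\le t<l_0),\,l_0)\,\frac1{l_0}\Big].$$ (ii) For every nonnegative measurable function $f$, $$\mathbb{E}\big[f((K_{t+P_{-1}}-K_{P_{-1}},\,0\le t<l_0),\,l_0)\big]=\mathbb{E}[l_1]^{-1}\,\mathbb{E}\big[f((K_{t+P_0}-K_{P_0},\,0\le t<l_1),\,l_1)\,l_1\big].$$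
   Context: $H$ is the space of real-valued càdlàg functions $z=(z_t)_{t\in\mathbb{R}}$ with $z_0=0$, with the $\sigma$-field $\mathcal{H}$ generated by the coordinate maps. $L$ is the space of sequences $(s_k)_{k\in\mathbb{Z}}\in\mathbb{R}^{\mathbb{Z}}$ with $-\infty\leftarrow\cdots<s_{-1}<0\le s_0<s_1<\cdots\to\infty$, with the trace $\mathcal{L}$ of the product $\sigma$-field. For $t\in\mathbb{R}$ the shift $\theta_t:H\times L\to H\times L$ is $$\theta_t((z_s)_{s\in\mathbb{R}},(s_k)_{k\in\mathbb{Z}})=((z_{t+s}-z_t)_{s\in\mathbb{R}},(s_{n_t+k}-t)_{k\in\mathbb{Z}}),$$ where $n_t=n$ if and only if $t\in(s_{n-1},s_n]$. The path segments are regarded as paths with finite lifetime (sent to a cemetery state after the end of the interval). *)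

theory Defs
  imports "HOL-Probability.Probability"
begin

definition cadlag_at :: "(real \<Rightarrow> real) \<Rightarrow> real \<Rightarrow> bool" where
  "cadlag_at z t \<longleftrightarrow> continuous (at_right t) z \<and> (\<exists>l. (z \<longlongrightarrow> l) (at_left t))"

definition H_paths :: "(real \<Rightarrow> real) set" where
  "H_paths = {z. (\<forall>t. cadlag_at z t) \<and> z 0 = 0}"

definition H_space :: "(real \<Rightarrow> real) measure" where
  "H_space = restrict_space (\<Pi>\<^sub>M t\<in>UNIV. borel) H_paths"

definition L_seqs :: "(int \<Rightarrow> real) set" where
  "L_seqs = {s. strict_mono s \<and> s (-1) < 0 \<and> 0 \<le> s 0 \<and>
     filterlim s at_top at_top \<and> filterlim s at_bot at_bot}"

definition L_space :: "(int \<Rightarrow> real) measure" where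
  "L_space = restrict_space (\<Pi>\<^sub>M k\<in>UNIV. borel) L_seqs"

definition epoch_index :: "(int \<Rightarrow> real) \<Rightarrow> real \<Rightarrow> int" where
  "epoch_index s t = (THE n. t \<in> {s (n - 1)<..s n})"

definition shift ::
    "real \<Rightarrow> (real \<Rightarrow> real) \<times> (int \<Rightarrow> real) \<Rightarrow> (real \<Rightarrow> real) \<times> (int \<Rightarrow> real)" where
  "shift t = (\<lambda>(z, s). (\<lambda>u. z (t + u) - z t, \<lambda>k. s (epoch_index s t + k) - t))"

definition space_homogeneous_stationary ::
    "'a measure \<Rightarrow> ('a \<Rightarrow> real \<Rightarrow> real) \<Rightarrow> ('a \<Rightarrow> int \<Rightarrow> real) \<Rightarrow> bool" where
  "space_homogeneous_stationary M K P \<longleftrightarrow>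
     (\<forall>t. distr M (H_space \<Otimes>\<^sub>M L_space) (\<lambda>\<omega>. shift t (K \<omega>, P \<omega>)) =
          distr M (H_space \<Otimes>\<^sub>M L_space) (\<lambda>\<omega>. (K \<omega>, P \<omega>)))"

text \<open>The state space is the real line with the cemetery state \<^term>\<open>None\<close> adjoined as an
  isolated point.\<close>

definition cemetery_borel :: "real option measure" where
  "cemetery_borel = sigma UNIV {A. Some -` A \<in> sets borel}"

text \<open>Cadlag paths with a lifetime \<open>\<zeta>\<close> that is positive and finite. Time runs over
  \<^term>\<open>{0::real..}\<close>, and by the convention for products the paths are
  \<^term>\<open>undefined\<close> at negative times. At time \<open>0\<close> only right-continuity is
  required.\<close>

definition killed_paths :: "(real \<Rightarrow> real option) set" where
  "killed_paths = {w. \<exists>\<zeta>>0. (\<forall>t\<ge>0. w t = None \<longleftrightarrow> \<zeta> \<le> t) \<and>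
     continuous (at_right 0) (\<lambda>u. the (w u)) \<and>
     (\<forall>t\<in>{0<..<\<zeta>}. cadlag_at (\<lambda>u. the (w u)) t)}"

definition killed_path_space :: "(real \<Rightarrow> real option) measure" where
  "killed_path_space = restrict_space (\<Pi>\<^sub>M t\<in>{0..}. cemetery_borel) killed_paths"

definition interval_length :: "(int \<Rightarrow> real) \<Rightarrow> int \<Rightarrow> real" where
  "interval_length s n = s n - s (n - 1)"

definition segment ::
    "(real \<Rightarrow> real) \<Rightarrow> (int \<Rightarrow> real) \<Rightarrow> int \<Rightarrow> real \<Rightarrow> real option" where
  "segment z s n = (\<lambda>t\<in>{0..}.
     if t < interval_length s n then Some (z (t + s (n - 1)) - z (s (n - 1))) else None)"

end

theory Submission
  imports Defs
begin

text \<open>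
  Write \<open>X\<^sub>n\<close> for the pair of the \<open>n\<close>-th path segment and its length \<open>l\<^sub>n\<close>, and \<open>n\<^sub>t\<close> for the
  index of the interval that contains \<open>t\<close>. Everything follows from the identity
  \<open>E[F(X\<^sub>1) / l\<^sub>0] = E[F(X\<^sub>0) / l\<^sub>0]\<close>, which stationarity gives for every measurable
  \<open>F \<ge> 0\<close> (lemma \<open>nn_integral_next_segment_over_length\<close>); it says that after weighting by
  \<open>1 / l\<^sub>0\<close>, which passes to the Palm distribution, \<open>X\<^sub>0\<close> and \<open>X\<^sub>1\<close> have the same law.

  The identity is an instance of the mass transport principle. Let each time \<open>s\<close> spread the
  mass \<open>F(X\<^sub>n\<^sub>+\<^sub>1) / l\<^sub>n\<close>, where \<open>n = n\<^sub>s\<close>, uniformly over the next interval: the density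
  of what \<open>s\<close> sends to \<open>t\<close> is \<open>F(X\<^sub>n\<^sub>+\<^sub>1) / (l\<^sub>n l\<^sub>n\<^sub>+\<^sub>1)\<close> if \<open>n\<^sub>t = n + 1\<close>, and \<open>0\<close>
  otherwise. This density is invariant under shifting \<open>s\<close>, \<open>t\<close> and the configuration together.
  By stationarity and Tonelli's theorem the expected mass sent out from time \<open>0\<close> equals the
  expected mass that time \<open>0\<close> receives. The former is \<open>E[F(X\<^sub>1) / l\<^sub>0]\<close>. The latter is
  \<open>E[F(X\<^sub>0) / l\<^sub>0]\<close>, because the senders fill an interval of length \<open>l\<^sub>-\<^sub>1\<close>, which cancels one
  factor of the density.

  With independence the left side factorises as \<open>E[F(X\<^sub>1)] E[1 / l\<^sub>0]\<close>. Taking for \<open>F\<close> the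
  length gives \<open>E[l\<^sub>1] E[1 / l\<^sub>0] = 1\<close>; so both expectations are positive and finite, and each is
  the inverse of the other. Taking \<open>F = f\<close> gives (i), and \<open>F = f\<close> times the length gives (ii).

  Stationarity can be applied only to measurable functionals of the configuration, so the shift
  and the segments have to be shown measurable. A segment evaluates the path at random times, which is
  a measurable operation because a right-continuous path is a limit of countably-valued
  discretisations.
\<close>

section \<open>Evaluation of right-continuous paths at random times\<close>

text \<open>The grid point strictly to the right of \<open>x\<close> approximates \<open>x\<close> from the right, so that
  right-continuity of a path can be used along it.\<close>

lemma tendsto_right_approximation:
  "filterlim (\<lambda>m. (real_of_int \<lfloor>real (Suc m) * x\<rfloor> + 1) / real (Suc m)) (at_right x) sequentially"
proof -
  have gt: "x < (real_of_int \<lfloor>real (Suc m) * x\<rfloor> + 1) / real (Suc m)" for m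
  proof -
    have "real (Suc m) * x < real_of_int \<lfloor>real (Suc m) * x\<rfloor> + 1" by linarith
    then show ?thesis by (simp add: pos_less_divide_eq mult.commute del: of_nat_Suc)
  qed
  have le: "(real_of_int \<lfloor>real (Suc m) * x\<rfloor> + 1) / real (Suc m) \<le> x + inverse (real (Suc m))" for m
  proof -
    have "(real_of_int \<lfloor>real (Suc m) * x\<rfloor> + 1) / real (Suc m) \<le> (real (Suc m) * x + 1) / real (Suc m)"
      by (intro divide_right_mono) auto
    also have "\<dots> = x + inverse (real (Suc m))" by (simp add: field_simps)
    finally show ?thesis .
  qed
  have "(\<lambda>m. (real_of_int \<lfloor>real (Suc m) * x\<rfloor> + 1) / real (Suc m)) \<longlonglongrightarrow> x"
  proof (rule tendsto_sandwich)
    show "(\<lambda>m. x) \<longlonglongrightarrow> x" by simp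
    show "(\<lambda>m. x + inverse (real (Suc m))) \<longlonglongrightarrow> x"
      using tendsto_add[OF tendsto_const LIMSEQ_inverse_real_of_nat, of x] by simp
    show "\<forall>\<^sub>F m in sequentially. x \<le> (real_of_int \<lfloor>real (Suc m) * x\<rfloor> + 1) / real (Suc m)"
      using gt less_imp_le by (intro always_eventually) blast
    show "\<forall>\<^sub>F m in sequentially. (real_of_int \<lfloor>real (Suc m) * x\<rfloor> + 1) / real (Suc m) \<le> x + inverse (real (Suc m))"
      using le by (intro always_eventually) blast
  qed
  then show ?thesis
    unfolding filterlim_at using gt by (auto intro!: always_eventually simp: less_imp_neq[symmetric] simp del: of_nat_Suc) 
qed

lemma space_H: "space H_space = H_paths" and space_L: "space L_space = L_seqs"
  by (auto simp: H_space_def L_space_def space_restrict_space space_PiM)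

lemma measurable_path_coordinate [measurable]: "(\<lambda>z. z t) \<in> borel_measurable H_space"
  unfolding H_space_def by (intro measurable_restrict_space1 measurable_component_singleton) simp

lemma measurable_seq_coordinate [measurable]: "(\<lambda>s. s k) \<in> borel_measurable L_space"
  unfolding L_space_def by (intro measurable_restrict_space1 measurable_component_singleton) simp

text \<open>The evaluation is jointly measurable because at the grid approximation of \<open>x\<close> it is a
  countable patchwork of coordinate maps, and right-continuity gives the limit.\<close>

lemma measurable_path_evaluation:
  "(\<lambda>(z, x). z x) \<in> borel_measurable (H_space \<Otimes>\<^sub>M borel)"
proof (rule borel_measurable_LIMSEQ_real)
  let ?a = "\<lambda>m x. (real_of_int \<lfloor>real (Suc m) * x\<rfloor> + 1) / real (Suc m)"
  show "(\<lambda>m. (\<lambda>(z, x). z (?a m x)) w) \<longlonglongrightarrow> (\<lambda>(z, x). z x) w"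
    if "w \<in> space (H_space \<Otimes>\<^sub>M borel)" for w :: "(real \<Rightarrow> real) \<times> real"
  proof -
    obtain z x where w: "w = (z, x)" "z \<in> H_paths"
      using \<open>w \<in> _\<close> by (cases w) (auto simp: space_pair_measure space_H)
    then have "(z \<longlongrightarrow> z x) (at_right x)"
      by (auto simp: H_paths_def cadlag_at_def continuous_within)
    from filterlim_compose[OF this tendsto_right_approximation] show ?thesis
      by (simp add: w)
  qed
  show "(\<lambda>(z, x). z (?a m x)) \<in> borel_measurable (H_space \<Otimes>\<^sub>M borel)" for m
  proof -
    have "(\<lambda>w. (\<lambda>i w. fst w ((real_of_int i + 1) / real (Suc m))) \<lfloor>real (Suc m) * snd w\<rfloor> w)
        \<in> borel_measurable (H_space \<Otimes>\<^sub>M borel)"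
      by (rule measurable_compose_countable) measurable
    then show ?thesis by (simp add: case_prod_beta)
  qed
qed

lemma measurable_evaluate_at:
  assumes "Z \<in> N \<rightarrow>\<^sub>M H_space" "T \<in> borel_measurable N"
  shows "(\<lambda>\<omega>. Z \<omega> (T \<omega>)) \<in> borel_measurable N"
  using measurable_compose[OF measurable_Pair[OF assms] measurable_path_evaluation] by simp

section \<open>The shift\<close>

lemma cadlag_at_cong:
  assumes "\<forall>\<^sub>F u in nhds t. f u = g u" "cadlag_at f t"
  shows "cadlag_at g t"
proof -
  have ev: "\<forall>\<^sub>F u in at t within S. f u = g u" for S
    using assms(1) by (rule filter_leD[rotated]) (simp add: at_within_def)
  have "(f \<longlongrightarrow> c) (at t within S) \<longleftrightarrow> (g \<longlongrightarrow> c) (at t within S)" for c S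
    using ev by (rule tendsto_cong)
  moreover have "f t = g t" using assms(1) by (rule eventually_nhds_x_imp_x)
  ultimately show ?thesis
    using assms(2) unfolding cadlag_at_def continuous_within
    by simp
qed

lemma cadlag_at_translate:
  assumes "cadlag_at z (a + x)"
  shows "cadlag_at (\<lambda>u. z (a + u) - c) x"
proof -
  have r: "filterlim (\<lambda>u. a + u) (at_right (a + x)) (at_right x)"
    and l: "filterlim (\<lambda>u. a + u) (at_left (a + x)) (at_left x)"
    by (auto simp: filterlim_at eventually_at_filter intro!: tendsto_eq_intros)
  from assms show ?thesis
    unfolding cadlag_at_def continuous_within
    by (auto intro!: tendsto_diff filterlim_compose[OF _ r] exI filterlim_compose[OF _ l])
qed

lemma epoch_index_eqI:
  assumes "s \<in> L_seqs" "s (n - 1) < t" "t \<le> s n"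
  shows "epoch_index s t = n"
  unfolding epoch_index_def
proof (rule the_equality)
  fix m assume m: "t \<in> {s (m - 1)<..s m}"
  have s: "strict_mono s" using assms(1) by (simp add: L_seqs_def)
  have "s (n - 1) < s m" "s (m - 1) < s n" using m assms by auto
  then show "m = n" using strict_mono_less[OF s] by force
qed (use assms in auto)

text \<open>As the sequence is below \<open>t\<close> far to the left and eventually at least \<open>t\<close>, there is a step
  at which it passes \<open>t\<close>.\<close>

lemma epoch_index_bounds:
  assumes "s \<in> L_seqs"
  shows "s (epoch_index s t - 1) < t" "t \<le> s (epoch_index s t)"
proof -
  have s: "strict_mono s" and top: "filterlim s at_top at_top" and bot: "filterlim s at_bot at_bot"
    using assms by (auto simp: L_seqs_def)
  obtain b where b: "t \<le> s b"
    using top by (auto simp: filterlim_at_top eventually_at_top_linorder)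
  obtain a where a: "\<And>k. k \<le> a \<Longrightarrow> s k \<le> t - 1"
    using bot unfolding filterlim_at_bot eventually_at_bot_linorder by blast
  have ab: "a \<le> b" using a[of b] b by force
  have "\<exists>n. s (n - 1) < t \<and> t \<le> s n"
  proof (rule ccontr)
    assume no: "\<nexists>n. s (n - 1) < t \<and> t \<le> s n"
    have "s k < t" if "a \<le> k" for k
      using that
    proof (induction k rule: int_ge_induct)
      case base then show ?case using a[of a] by simp
    next
      case (step i)
      then show ?case using no[simplified, rule_format, of "i + 1"] by simp
    qed
    from this[OF ab] b show False by simp
  qed
  then obtain n where "s (n - 1) < t" "t \<le> s n" by blast
  with epoch_index_eqI[OF assms this] 
  show "s (epoch_index s t - 1) < t" "t \<le> s (epoch_index s t)" by auto
qed

lemma shift_in_H_paths: "z \<in> H_paths \<Longrightarrow> (\<lambda>u. z (t + u) - z t) \<in> H_paths"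
  by (auto simp: H_paths_def intro!: cadlag_at_translate)

lemma shift_in_L_seqs:
  assumes "s \<in> L_seqs"
  shows "(\<lambda>k. s (epoch_index s t + k) - t) \<in> L_seqs"
proof -
  let ?n = "epoch_index s t"
  have s: "strict_mono s" and top: "filterlim s at_top at_top" and bot: "filterlim s at_bot at_bot"
    using assms by (auto simp: L_seqs_def)
  have 1: "filterlim (\<lambda>k. ?n + k) at_top at_top"
    unfolding filterlim_at_top eventually_at_top_linorder
    by (metis add.commute add_le_cancel_right diff_add_cancel)
  have 2: "filterlim (\<lambda>k. ?n + k) at_bot at_bot"
    unfolding filterlim_at_bot eventually_at_bot_linorder
    by (metis add.commute add_le_cancel_right diff_add_cancel)
  have "filterlim (\<lambda>k. - t + s (?n + k)) at_top at_top"
    by (rule filterlim_tendsto_add_at_top[OF tendsto_const filterlim_compose[OF top 1]])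
  moreover have "filterlim (\<lambda>k. - t + s (?n + k)) at_bot at_bot"
    by (rule filterlim_tendsto_add_at_bot_iff[OF tendsto_const, THEN iffD2, OF filterlim_compose[OF bot 2]])
  moreover have "strict_mono (\<lambda>k. s (?n + k) - t)"
    using s by (auto simp: strict_mono_def)
  ultimately show ?thesis
    using epoch_index_bounds[OF assms, of t] by (simp add: L_seqs_def)
qed

lemma measurable_epoch_index:
  "(\<lambda>s. epoch_index s t) \<in> L_space \<rightarrow>\<^sub>M count_space UNIV"
proof (rule measurable_count_space_eq2_countable[THEN iffD2, rotated], safe)
  fix n
  have "(\<lambda>s. epoch_index s t) -` {n} \<inter> space L_space
      = {s \<in> space L_space. s (n - 1) < t \<and> t \<le> s n}"
    using epoch_index_bounds epoch_index_eqI by (auto simp: space_L)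
  also have "\<dots> \<in> sets L_space" by measurable
  finally show "(\<lambda>s. epoch_index s t) -` {n} \<inter> space L_space \<in> sets L_space" .
qed auto

lemma measurable_shift:
  "shift t \<in> H_space \<Otimes>\<^sub>M L_space \<rightarrow>\<^sub>M H_space \<Otimes>\<^sub>M L_space"
proof -
  have "(\<lambda>z u. z (t + u) - z t) \<in> H_space \<rightarrow>\<^sub>M H_space"
    by (subst (2) H_space_def, rule measurable_restrict_space2)
       (auto simp: space_H shift_in_H_paths intro!: measurable_PiM_single')
  moreover have "(\<lambda>s k. s (epoch_index s t + k) - t) \<in> L_space \<rightarrow>\<^sub>M L_space"
  proof (subst (2) L_space_def, rule measurable_restrict_space2)
    show "(\<lambda>s k. s (epoch_index s t + k) - t) \<in> L_space \<rightarrow>\<^sub>M (\<Pi>\<^sub>M k\<in>UNIV. borel)"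
    proof (rule measurable_PiM_single')
      fix k
      show "(\<lambda>s. s (epoch_index s t + k) - t) \<in> borel_measurable L_space"
        by (rule measurable_compose_countable[OF _ measurable_epoch_index]) measurable
    qed auto
  qed (auto simp: space_L shift_in_L_seqs)
  ultimately show ?thesis
    unfolding shift_def by measurable
qed

section \<open>The path segments\<close>

lemma interval_length_pos: "s \<in> L_seqs \<Longrightarrow> 0 < interval_length s n"
  by (auto simp: interval_length_def L_seqs_def strict_mono_def)

lemma segment_in_killed_paths:
  assumes z: "z \<in> H_paths" and s: "s \<in> L_seqs"
  shows "segment z s n \<in> killed_paths"
proof -
  let ?l = "interval_length s n" and ?a = "s (n - 1)"
  let ?y = "\<lambda>u. z (?a + u) - z ?a"
  have y: "cadlag_at ?y t" for t
    using z by (auto simp: H_paths_def intro!: cadlag_at_translate)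
  have l: "0 < ?l" by (rule interval_length_pos[OF s])
  have eq: "?y u = the (segment z s n u)" if "0 \<le> u" "u < ?l" for u
    using that by (simp add: segment_def add.commute)
  have "cadlag_at (\<lambda>u. the (segment z s n u)) t" if "t \<in> {0<..<?l}" for t
  proof (rule cadlag_at_cong[OF _ y])
    show "\<forall>\<^sub>F u in nhds t. ?y u = the (segment z s n u)"
      using eventually_nhds_in_open[OF open_greaterThanLessThan that]
      by eventually_elim (auto intro: eq)
  qed
  moreover have "continuous (at_right 0) (\<lambda>u. the (segment z s n u))"
  proof -
    have "(?y \<longlongrightarrow> ?y 0) (at_right 0)"
      using y[of 0] by (simp add: cadlag_at_def continuous_within)
    moreover have "\<forall>\<^sub>F u in at_right 0. ?y u = the (segment z s n u)"
      using eventually_at_right_real[OF l] by eventually_elim (auto intro: eq)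
    ultimately have "((\<lambda>u. the (segment z s n u)) \<longlongrightarrow> ?y 0) (at_right 0)"
      by (rule Lim_transform_eventually)
    with eq[of 0] l show ?thesis by (simp add: continuous_within)
  qed
  moreover have "\<forall>t\<ge>0. segment z s n t = None \<longleftrightarrow> ?l \<le> t"
    by (auto simp: segment_def)
  ultimately show ?thesis
    using l unfolding killed_paths_def by blast
qed

text \<open>The cemetery state is isolated, so killing a real random variable off a measurable event
  keeps it measurable.\<close>

lemma measurable_into_cemetery:
  assumes B: "B \<in> sets N" and g: "g \<in> borel_measurable N"
  shows "(\<lambda>\<omega>. if \<omega> \<in> B then Some (g \<omega>) else None) \<in> N \<rightarrow>\<^sub>M cemetery_borel"
  unfolding cemetery_borel_def
proof (rule measurable_measure_of)
  fix A :: "real option set" assume "A \<in> {A. Some -` A \<in> sets borel}"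
  then have A: "g -` (Some -` A) \<inter> space N \<in> sets N"
    using g by (auto intro: measurable_sets)
  have "(\<lambda>\<omega>. if \<omega> \<in> B then Some (g \<omega>) else None) -` A \<inter> space N
      = (B \<inter> (g -` (Some -` A) \<inter> space N)) \<union> (if None \<in> A then space N - B else {})"
    using sets.sets_into_space[OF B] by (auto split: if_splits)
  with A B show "(\<lambda>\<omega>. if \<omega> \<in> B then Some (g \<omega>) else None) -` A \<inter> space N \<in> sets N"
    by auto
qed auto

lemma measurable_interval_length [measurable]:
  "(\<lambda>s. interval_length s n) \<in> borel_measurable L_space"
  unfolding interval_length_def by measurable

lemma measurable_segment:
  "(\<lambda>(z, s). segment z s n) \<in> H_space \<Otimes>\<^sub>M L_space \<rightarrow>\<^sub>M killed_path_space"
  unfolding killed_path_space_def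
proof (rule measurable_restrict_space2)
  let ?N = "H_space \<Otimes>\<^sub>M L_space"
  show "(\<lambda>(z, s). segment z s n) \<in> space ?N \<rightarrow> killed_paths"
    by (auto simp: space_pair_measure space_H space_L segment_in_killed_paths)
  show "(\<lambda>(z, s). segment z s n) \<in> ?N \<rightarrow>\<^sub>M (\<Pi>\<^sub>M t\<in>{0..}. cemetery_borel)"
  proof (rule measurable_PiM_single')
    fix t :: real assume t: "t \<in> {0..}"
    let ?B = "{w \<in> space ?N. t < interval_length (snd w) n}"
    let ?g = "\<lambda>w. fst w (t + snd w (n - 1)) - fst w (snd w (n - 1))"
    have "(\<lambda>w. if w \<in> ?B then Some (?g w) else None) \<in> ?N \<rightarrow>\<^sub>M cemetery_borel"
    proof (rule measurable_into_cemetery)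
      \<comment> \<open>Here the path is evaluated at random times.\<close>
      show "?g \<in> borel_measurable ?N"
        by (rule borel_measurable_diff; rule measurable_evaluate_at) measurable
    qed measurable
    then show "(\<lambda>w. (case w of (z, s) \<Rightarrow> segment z s n) t) \<in> ?N \<rightarrow>\<^sub>M cemetery_borel"
      by (rule measurable_cong[THEN iffD1, rotated]) (use t in \<open>auto simp: segment_def\<close>)
  qed (auto simp: segment_def cemetery_borel_def split: if_splits)
qed

lemma interval_length_shift: "interval_length (\<lambda>k. s (m + k) - t) n = interval_length s (m + n)"
  by (simp add: interval_length_def add_diff_eq)

text \<open>A segment is taken relative to its own starting point, so a shift of the configuration
  only relabels the segments.\<close>

lemma segment_shift:
  "segment (\<lambda>u. z (t + u) - z t) (\<lambda>k. s (m + k) - t) n = segment z s (m + n)"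
  unfolding segment_def interval_length_shift
  by (rule restrict_ext) (simp add: add_diff_eq add.assoc)

section \<open>Mass transport\<close>

lemma stationary_nn_integral:
  assumes XM: "(\<lambda>\<omega>. (K \<omega>, P \<omega>)) \<in> M \<rightarrow>\<^sub>M H_space \<Otimes>\<^sub>M L_space"
    and stat: "space_homogeneous_stationary M K P"
    and G: "G \<in> borel_measurable (H_space \<Otimes>\<^sub>M L_space)"
  shows "(\<integral>\<^sup>+\<omega>. G (shift t (K \<omega>, P \<omega>)) \<partial>M) = (\<integral>\<^sup>+\<omega>. G (K \<omega>, P \<omega>) \<partial>M)"
proof -
  have "(\<integral>\<^sup>+\<omega>. G (shift t (K \<omega>, P \<omega>)) \<partial>M)
      = (\<integral>\<^sup>+x. G x \<partial>distr M (H_space \<Otimes>\<^sub>M L_space) (\<lambda>\<omega>. shift t (K \<omega>, P \<omega>)))"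
    using measurable_compose[OF XM measurable_shift] G by (subst nn_integral_distr) simp_all
  also have "\<dots> = (\<integral>\<^sup>+x. G x \<partial>distr M (H_space \<Otimes>\<^sub>M L_space) (\<lambda>\<omega>. (K \<omega>, P \<omega>)))"
    using stat by (simp add: space_homogeneous_stationary_def)
  also have "\<dots> = (\<integral>\<^sup>+\<omega>. G (K \<omega>, P \<omega>) \<partial>M)"
    using XM G by (subst nn_integral_distr) simp_all
  finally show ?thesis .
qed

lemma ennreal_inverse_length_cancel:
  "0 < r \<Longrightarrow> c * ennreal (1 / r) * ennreal r = c"
  by (simp add: mult.assoc ennreal_mult''[symmetric])

lemma ennreal_inverse_unique:
  fixes x y :: ennreal
  assumes "x * y = 1"
  shows "inverse x = y"
proof -
  have "x \<noteq> 0" "x \<noteq> \<top>"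
    using assms by (auto simp: ennreal_top_mult split: if_splits)
  then have "y * x / x = y"
    by (rule ennreal_mult_divide_eq)
  with assms show ?thesis
    by (simp add: divide_ennreal_def mult.commute)
qed

text \<open>Mass transport between consecutive intervals. In the proof \<open>out w t\<close> is the density of the
  mass sent from \<open>0\<close> to \<open>t\<close>, and \<open>inn w t\<close> the density of the mass received at \<open>0\<close> from \<open>- t\<close>.
  Shifting the configuration by \<open>- t\<close> turns the first into the second.\<close>

lemma nn_integral_next_segment_over_length:
  assumes "prob_space M"
    and XM: "(\<lambda>\<omega>. (K \<omega>, P \<omega>)) \<in> M \<rightarrow>\<^sub>M H_space \<Otimes>\<^sub>M L_space"
    and stat: "space_homogeneous_stationary M K P"
    and F [measurable]: "F \<in> borel_measurable (killed_path_space \<Otimes>\<^sub>M borel)"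
  shows "(\<integral>\<^sup>+\<omega>. F (segment (K \<omega>) (P \<omega>) 1, interval_length (P \<omega>) 1)
              * ennreal (1 / interval_length (P \<omega>) 0) \<partial>M)
       = (\<integral>\<^sup>+\<omega>. F (segment (K \<omega>) (P \<omega>) 0, interval_length (P \<omega>) 0)
              * ennreal (1 / interval_length (P \<omega>) 0) \<partial>M)"
proof -
  interpret prob_space M by fact
  interpret pair_sigma_finite lborel M ..
  note measurable_segment [measurable] and XM [measurable]
  let ?X = "\<lambda>\<omega>. (K \<omega>, P \<omega>)"
  define a where "a k w = F (segment (fst w) (snd w) k, interval_length (snd w) k)
      * ennreal (1 / interval_length (snd w) (k - 1)) * ennreal (1 / interval_length (snd w) k)"
    for k and w :: "(real \<Rightarrow> real) \<times> (int \<Rightarrow> real)"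
  define out where "out w t = a 1 w * indicator {snd w 0<..snd w 1} t"
    for w :: "(real \<Rightarrow> real) \<times> (int \<Rightarrow> real)" and t :: real
  define inn where "inn w t = a 0 w * indicator {- snd w (-1)..<- snd w (-2)} t"
    for w :: "(real \<Rightarrow> real) \<times> (int \<Rightarrow> real)" and t :: real
  have seg [measurable]: "(\<lambda>w. segment (fst w) (snd w) k) \<in> H_space \<Otimes>\<^sub>M L_space \<rightarrow>\<^sub>M killed_path_space" for k
    using measurable_segment[of k] by (simp add: case_prod_beta)
  have a_meas [measurable]: "a k \<in> borel_measurable (H_space \<Otimes>\<^sub>M L_space)" for k
    unfolding a_def[abs_def] by measurable
  have out_meas [measurable]: "(\<lambda>(t, w). out w t) \<in> borel_measurable (borel \<Otimes>\<^sub>M (H_space \<Otimes>\<^sub>M L_space))"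
    unfolding out_def greaterThanAtMost_iff indicator_def by measurable
  have inn_meas [measurable]: "(\<lambda>(t, w). inn w t) \<in> borel_measurable (borel \<Otimes>\<^sub>M (H_space \<Otimes>\<^sub>M L_space))"
    unfolding inn_def atLeastLessThan_iff indicator_def by measurable
  have XS: "K \<omega> \<in> H_paths" "P \<omega> \<in> L_seqs" if "\<omega> \<in> space M" for \<omega>
    using measurable_space[OF XM that] by (auto simp: space_pair_measure space_H space_L)
  have cov: "out (shift (- t) w) t = inn w t" if "snd w \<in> L_seqs" for w t
  proof -
    obtain z s where w: "w = (z, s)" by (cases w)
    define n where "n = epoch_index s (- t)"
    have s: "s \<in> L_seqs" using that by (simp add: w)
    \<comment> \<open>After the shift, \<open>t\<close> lies in the interval after the one of \<open>0\<close> exactly if, before it, \<open>0\<close>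
        lies in the interval after the one of \<open>- t\<close>; the interval of \<open>0\<close> has index \<open>0\<close>.\<close>
    have "s (n + 0) + t < t \<and> t \<le> s (n + 1) + t \<longleftrightarrow> n = -1"
    proof
      assume "s (n + 0) + t < t \<and> t \<le> s (n + 1) + t"
      then have "epoch_index s 0 = n + 1" by (intro epoch_index_eqI[OF s]) auto
      moreover have "epoch_index s 0 = 0"
        using s by (intro epoch_index_eqI[OF s]) (auto simp: L_seqs_def)
      ultimately show "n = -1" by simp
    qed (use s in \<open>auto simp: L_seqs_def\<close>)
    moreover have "- t \<in> {s (-2)<..s (-1)} \<longleftrightarrow> n = -1"
      using epoch_index_bounds[OF s, of "- t"] epoch_index_eqI[OF s, of "-1" "- t"]
      by (auto simp: n_def)
    moreover have "a 1 (shift (- t) w) = a (n + 1) w"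
      using segment_shift[of z "- t" s n 1] interval_length_shift[of s n "- t"]
      by (simp add: a_def shift_def w n_def)
    ultimately show ?thesis
      by (auto simp: out_def inn_def w shift_def n_def indicator_def)
  qed
  have int_out: "(\<integral>\<^sup>+t. out w t \<partial>lborel)
      = F (segment (fst w) (snd w) 1, interval_length (snd w) 1) * ennreal (1 / interval_length (snd w) 0)"
    if "snd w \<in> L_seqs" for w
  proof -
    have l: "0 < interval_length (snd w) 1" by (rule interval_length_pos[OF that])
    then have "(\<integral>\<^sup>+t. out w t \<partial>lborel) = a 1 w * ennreal (interval_length (snd w) 1)"
      by (simp add: out_def nn_integral_cmult_indicator interval_length_def)
    with ennreal_inverse_length_cancel[OF l] show ?thesis
      by (simp add: a_def)
  qed
  have int_inn: "(\<integral>\<^sup>+t. inn w t \<partial>lborel)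
      = F (segment (fst w) (snd w) 0, interval_length (snd w) 0) * ennreal (1 / interval_length (snd w) 0)"
    if "snd w \<in> L_seqs" for w
  proof -
    have l: "0 < interval_length (snd w) (-1)" by (rule interval_length_pos[OF that])
    then have "(\<integral>\<^sup>+t. inn w t \<partial>lborel) = a 0 w * ennreal (interval_length (snd w) (-1))"
      by (simp add: inn_def nn_integral_cmult_indicator interval_length_def)
    also have "a 0 w = F (segment (fst w) (snd w) 0, interval_length (snd w) 0)
        * ennreal (1 / interval_length (snd w) 0) * ennreal (1 / interval_length (snd w) (-1))"
      by (simp add: a_def mult_ac)
    finally show ?thesis
      using ennreal_inverse_length_cancel[OF l] by simp
  qed
  have "(\<integral>\<^sup>+\<omega>. F (segment (K \<omega>) (P \<omega>) 1, interval_length (P \<omega>) 1)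
              * ennreal (1 / interval_length (P \<omega>) 0) \<partial>M)
      = (\<integral>\<^sup>+\<omega>. \<integral>\<^sup>+t. out (?X \<omega>) t \<partial>lborel \<partial>M)"
    by (intro nn_integral_cong) (simp add: int_out XS)
  also have "\<dots> = (\<integral>\<^sup>+t. \<integral>\<^sup>+\<omega>. out (?X \<omega>) t \<partial>M \<partial>lborel)"
    by (rule Fubini') measurable
  also have "\<dots> = (\<integral>\<^sup>+t. \<integral>\<^sup>+\<omega>. out (shift (- t) (?X \<omega>)) t \<partial>M \<partial>lborel)"
    by (intro nn_integral_cong stationary_nn_integral[OF XM stat, symmetric]) measurable
  also have "\<dots> = (\<integral>\<^sup>+t. \<integral>\<^sup>+\<omega>. inn (?X \<omega>) t \<partial>M \<partial>lborel)"
    by (intro nn_integral_cong) (simp add: cov XS)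
  also have "\<dots> = (\<integral>\<^sup>+\<omega>. \<integral>\<^sup>+t. inn (?X \<omega>) t \<partial>lborel \<partial>M)"
    by (rule Fubini'[symmetric]) measurable
  also have "\<dots> = (\<integral>\<^sup>+\<omega>. F (segment (K \<omega>) (P \<omega>) 0, interval_length (P \<omega>) 0)
              * ennreal (1 / interval_length (P \<omega>) 0) \<partial>M)"
    by (intro nn_integral_cong) (simp add: int_inn XS)
  finally show ?thesis .
qed

section \<open>The laws of consecutive segments\<close>

theorem corollary4p7:
  fixes M :: "'a measure"
    and K :: "'a \<Rightarrow> real \<Rightarrow> real"
    and P :: "'a \<Rightarrow> int \<Rightarrow> real"
    and l :: "int \<Rightarrow> 'a \<Rightarrow> real"
  assumes "prob_space M"
    and "(\<lambda>\<omega>. (K \<omega>, P \<omega>)) \<in> M \<rightarrow>\<^sub>M H_space \<Otimes>\<^sub>M L_space"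
    and "space_homogeneous_stationary M K P"
    and "\<And>n \<omega>. l n \<omega> = interval_length (P \<omega>) n"
    and "prob_space.indep_vars M (\<lambda>_. killed_path_space \<Otimes>\<^sub>M borel)
           (\<lambda>n \<omega>. (segment (K \<omega>) (P \<omega>) n, l n \<omega>)) (UNIV :: int set)"
  shows "(\<forall>f :: (real \<Rightarrow> real option) \<times> real \<Rightarrow> ennreal.
            f \<in> borel_measurable (killed_path_space \<Otimes>\<^sub>M borel) \<longrightarrow>
            (\<integral>\<^sup>+\<omega>. f (segment (K \<omega>) (P \<omega>) 1, l 1 \<omega>) \<partial>M) =
              inverse (\<integral>\<^sup>+\<omega>. ennreal (1 / l 0 \<omega>) \<partial>M) *
              (\<integral>\<^sup>+\<omega>. f (segment (K \<omega>) (P \<omega>) 0, l 0 \<omega>) * ennreal (1 / l 0 \<omega>) \<partial>M)) \<and>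
         (\<forall>f :: (real \<Rightarrow> real option) \<times> real \<Rightarrow> ennreal.
            f \<in> borel_measurable (killed_path_space \<Otimes>\<^sub>M borel) \<longrightarrow>
            (\<integral>\<^sup>+\<omega>. f (segment (K \<omega>) (P \<omega>) 0, l 0 \<omega>) \<partial>M) =
              inverse (\<integral>\<^sup>+\<omega>. ennreal (l 1 \<omega>) \<partial>M) *
              (\<integral>\<^sup>+\<omega>. f (segment (K \<omega>) (P \<omega>) 1, l 1 \<omega>) * ennreal (l 1 \<omega>) \<partial>M))"
proof -
  interpret prob_space M by fact
  let ?S = "killed_path_space \<Otimes>\<^sub>M (borel :: real measure)"
  let ?X = "\<lambda>n \<omega>. (segment (K \<omega>) (P \<omega>) n, l n \<omega>)"
  let ?c = "\<integral>\<^sup>+\<omega>. ennreal (1 / l 0 \<omega>) \<partial>M" and ?m = "\<integral>\<^sup>+\<omega>. ennreal (l 1 \<omega>) \<partial>M"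
  have l_pos: "0 < l n \<omega>" if "\<omega> \<in> space M" for n \<omega>
    using measurable_space[OF assms(2) that] assms(4)
    by (auto simp: space_pair_measure space_L interval_length_pos)
  have key: "(\<integral>\<^sup>+\<omega>. F (?X 1 \<omega>) \<partial>M) * ?c = (\<integral>\<^sup>+\<omega>. F (?X 0 \<omega>) * ennreal (1 / l 0 \<omega>) \<partial>M)"
    if F [measurable]: "F \<in> borel_measurable ?S" for F
  proof -
    define Y where "Y n = (if n = 1 then F else (\<lambda>x. ennreal (1 / snd x)))" for n :: int
    have "indep_vars (\<lambda>_. borel) (\<lambda>n \<omega>. Y n (?X n \<omega>)) {0, 1}"
      by (rule indep_vars_compose2[OF indep_vars_subset[OF assms(5)]]) (auto simp: Y_def)
    from indep_vars_nn_integral[OF _ this]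
    have "(\<integral>\<^sup>+\<omega>. F (?X 1 \<omega>) \<partial>M) * ?c = (\<integral>\<^sup>+\<omega>. F (?X 1 \<omega>) * ennreal (1 / l 0 \<omega>) \<partial>M)"
      by (simp add: Y_def mult.commute)
    then show ?thesis
      using nn_integral_next_segment_over_length[OF assms(1-3) F] by (simp add: assms(4))
  qed
  have "?m * ?c = (\<integral>\<^sup>+\<omega>. ennreal (l 0 \<omega>) * ennreal (1 / l 0 \<omega>) \<partial>M)"
    using key[of "\<lambda>x. ennreal (snd x)"] by simp
  also have "\<dots> = (\<integral>\<^sup>+\<omega>. 1 \<partial>M)"
  proof (rule nn_integral_cong)
    fix \<omega> assume "\<omega> \<in> space M"
    from ennreal_inverse_length_cancel[OF l_pos[OF this, of 0], of 1]
    show "ennreal (l 0 \<omega>) * ennreal (1 / l 0 \<omega>) = 1" by (simp add: mult.commute)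
  qed
  finally have mc: "?m * ?c = 1" by (simp add: emeasure_space_1)
  have inv: "inverse x = y" if "x * y = 1" for x y :: ennreal
    using that by (rule ennreal_inverse_unique)
  have c: "inverse ?c = ?m" and m: "inverse ?m = ?c"
    using mc by (auto intro!: inv simp: mult.commute)
  show ?thesis
  proof (intro conjI allI impI)
    fix f :: "(real \<Rightarrow> real option) \<times> real \<Rightarrow> ennreal"
    assume f [measurable]: "f \<in> borel_measurable ?S"
    show "(\<integral>\<^sup>+\<omega>. f (?X 1 \<omega>) \<partial>M) = inverse ?c * (\<integral>\<^sup>+\<omega>. f (?X 0 \<omega>) * ennreal (1 / l 0 \<omega>) \<partial>M)"
      unfolding c key[OF f, symmetric]
      by (subst mult.left_commute) (simp only: mc mult_1_right)
    have "inverse ?m * (\<integral>\<^sup>+\<omega>. f (?X 1 \<omega>) * ennreal (l 1 \<omega>) \<partial>M)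
        = (\<integral>\<^sup>+\<omega>. f (?X 0 \<omega>) * ennreal (l 0 \<omega>) * ennreal (1 / l 0 \<omega>) \<partial>M)"
      using key[of "\<lambda>x. f x * ennreal (snd x)"] by (simp add: m mult.commute)
    also have "\<dots> = (\<integral>\<^sup>+\<omega>. f (?X 0 \<omega>) \<partial>M)"
    proof (rule nn_integral_cong)
      fix \<omega> assume "\<omega> \<in> space M"
      from ennreal_inverse_length_cancel[OF l_pos[OF this, of 0], of "f (?X 0 \<omega>)"]
      show "f (?X 0 \<omega>) * ennreal (l 0 \<omega>) * ennreal (1 / l 0 \<omega>) = f (?X 0 \<omega>)"
        by (simp add: mult_ac)
    qed
    finally show "(\<integral>\<^sup>+\<omega>. f (?X 0 \<omega>) \<partial>M)
        = inverse ?m * (\<integral>\<^sup>+\<omega>. f (?X 1 \<omega>) * ennreal (l 1 \<omega>) \<partial>M)" by simp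
  qed
qed

end
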